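(* Let $G$ be a group and let $X_1,X_2$ be finite $G$-sets. Then for $i=1,2$ there are $G$-sets $Y_i$ and $G$-maps $h_i:X_i\to Y_i$ such that (1) $Y_1$ and $Y_2$ have the same Galois closure, and (2) $h_1\times h_2:X_1\times X_2\to Y_1\times Y_2$ induces a bijection between the set of $G$-orbits of $X_1\times X_2$ and the set of $G$-orbits of $Y_1\times Y_2$ (with diagonal action).
   Context: A normal subgroup $N\trianglelefteq G$ is a normal stabilizer of a $G$-set $X$ if $N$ fixes every point of $X$. The Galois group of $X$ is its maximal normal stabilizer. Two $G$-sets have the same Galois closure if they have the same Galois group. A $G$-map sends orbits onto orbits, giving a well-defined map on orbit sets. *)

theory Defs
  imports "HOL-Algebra.Group_Action"
begin

definition normal_stabilizer ::
    "('g, 'm) monoid_scheme \<Rightarrow> 'a set \<Rightarrow> ('g \<Rightarrow> 'a \<Rightarrow> 'a) \<Rightarrow> 'g set \<Rightarrow> bool" where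
  "normal_stabilizer G X \<phi> N \<longleftrightarrow> N \<lhd> G \<and> (\<forall>n\<in>N. \<forall>x\<in>X. \<phi> n x = x)"

text \<open>\<open>GREATEST\<close> is taken with respect to inclusion; the lemmas \<open>galois_group_normal_stabilizer\<close>
  and \<open>galois_group_greatest\<close> below show that it exists for every action.\<close>

definition galois_group ::
    "('g, 'm) monoid_scheme \<Rightarrow> 'a set \<Rightarrow> ('g \<Rightarrow> 'a \<Rightarrow> 'a) \<Rightarrow> 'g set" where
  "galois_group G X \<phi> = (GREATEST N. normal_stabilizer G X \<phi> N)"

definition same_galois_closure ::
    "('g, 'm) monoid_scheme \<Rightarrow> 'a set \<Rightarrow> ('g \<Rightarrow> 'a \<Rightarrow> 'a) \<Rightarrow> 'b set \<Rightarrow> ('g \<Rightarrow> 'b \<Rightarrow> 'b) \<Rightarrow> bool" where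
  "same_galois_closure G X \<phi> Y \<psi> \<longleftrightarrow> galois_group G X \<phi> = galois_group G Y \<psi>"

definition G_maps ::
    "('g, 'm) monoid_scheme \<Rightarrow> 'a set \<Rightarrow> ('g \<Rightarrow> 'a \<Rightarrow> 'a) \<Rightarrow> 'b set \<Rightarrow> ('g \<Rightarrow> 'b \<Rightarrow> 'b) \<Rightarrow> ('a \<Rightarrow> 'b) set" where
  "G_maps G X \<phi> Y \<psi> = {h \<in> X \<rightarrow> Y. \<forall>g\<in>carrier G. \<forall>x\<in>X. h (\<phi> g x) = \<psi> g (h x)}"

text \<open>The restriction to \<open>X \<times> Y\<close> is needed because the elements of \<open>BijGroup\<close>
  are extensional functions.\<close>

definition diag_action ::
    "'a set \<Rightarrow> ('g \<Rightarrow> 'a \<Rightarrow> 'a) \<Rightarrow> 'b set \<Rightarrow> ('g \<Rightarrow> 'b \<Rightarrow> 'b) \<Rightarrow> 'g \<Rightarrow> 'a \<times> 'b \<Rightarrow> 'a \<times> 'b" where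
  "diag_action X \<phi> Y \<psi> g = (\<lambda>p\<in>X \<times> Y. (\<phi> g (fst p), \<psi> g (snd p)))"

lemma (in group_action) kernel_fixes_iff:
  assumes "g \<in> carrier G"
  shows "g \<in> kernel G (BijGroup E) \<phi> \<longleftrightarrow> (\<forall>x\<in>E. \<phi> g x = x)"
proof
  assume "g \<in> kernel G (BijGroup E) \<phi>"
  then show "\<forall>x\<in>E. \<phi> g x = x" by (simp add: kernel_def BijGroup_def)
next
  assume fixed: "\<forall>x\<in>E. \<phi> g x = x"
  have "\<phi> g \<in> extensional E"
    using bij_prop0[OF assms] by (simp add: Bij_def)
  then have "\<phi> g = (\<lambda>x\<in>E. x)"
    using fixed by (auto simp: extensional_def fun_eq_iff)
  then show "g \<in> kernel G (BijGroup E) \<phi>"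
    using assms by (simp add: kernel_def BijGroup_def)
qed

lemma (in group_action) galois_group_eq_kernel:
  "galois_group G E \<phi> = kernel G (BijGroup E) \<phi>"
  unfolding galois_group_def
proof (rule Greatest_equality)
  have "x \<in> carrier G" if "x \<in> kernel G (BijGroup E) \<phi>" for x
    using that by (simp add: kernel_def)
  then show "normal_stabilizer G E \<phi> (kernel G (BijGroup E) \<phi>)"
    unfolding normal_stabilizer_def using group_hom.normal_kernel[OF group_hom] kernel_fixes_iff by blast
next
  fix M assume M: "normal_stabilizer G E \<phi> M"
  then have "M \<subseteq> carrier G"
    by (simp add: normal_stabilizer_def normal_imp_subgroup subgroup.subset)
  then show "M \<le> kernel G (BijGroup E) \<phi>"
    using M kernel_fixes_iff unfolding normal_stabilizer_def by blast
qed

lemma (in group_action) galois_group_normal_stabilizer: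
  "normal_stabilizer G E \<phi> (galois_group G E \<phi>)"
proof -
  have "x \<in> carrier G" if "x \<in> kernel G (BijGroup E) \<phi>" for x
    using that by (simp add: kernel_def)
  then show ?thesis
    unfolding normal_stabilizer_def galois_group_eq_kernel
    using group_hom.normal_kernel[OF group_hom] kernel_fixes_iff by blast
qed

lemma (in group_action) galois_group_greatest:
  assumes "normal_stabilizer G E \<phi> M"
  shows "M \<subseteq> galois_group G E \<phi>"
proof -
  have "M \<subseteq> carrier G"
    using assms by (simp add: normal_stabilizer_def normal_imp_subgroup subgroup.subset)
  then show ?thesis
    using assms kernel_fixes_iff unfolding normal_stabilizer_def galois_group_eq_kernel by blast
qed

lemma group_action_diag_action:
  assumes "group_action G X \<phi>" and "group_action G Y \<psi>"
  shows "group_action G (X \<times> Y) (diag_action X \<phi> Y \<psi>)"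
proof -
  interpret A: group_action G X \<phi> by fact
  interpret B: group_action G Y \<psi> by fact
  have bij: "diag_action X \<phi> Y \<psi> g \<in> Bij (X \<times> Y)" if g: "g \<in> carrier G" for g
  proof -
    have "bij_betw (map_prod (\<phi> g) (\<psi> g)) (X \<times> Y) (X \<times> Y)"
      using A.bij_prop0[OF g] B.bij_prop0[OF g] by (simp add: Bij_def bij_betw_map_prod)
    moreover have "bij_betw (diag_action X \<phi> Y \<psi> g) (X \<times> Y) (X \<times> Y)
        \<longleftrightarrow> bij_betw (map_prod (\<phi> g) (\<psi> g)) (X \<times> Y) (X \<times> Y)"
      by (rule bij_betw_cong) (auto simp: diag_action_def)
    ultimately show ?thesis by (simp add: Bij_def diag_action_def)
  qed
  have "diag_action X \<phi> Y \<psi> (g \<otimes>\<^bsub>G\<^esub> h)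
      = compose (X \<times> Y) (diag_action X \<phi> Y \<psi> g) (diag_action X \<phi> Y \<psi> h)"
    if g: "g \<in> carrier G" and h: "h \<in> carrier G" for g h
  proof
    fix p
    show "diag_action X \<phi> Y \<psi> (g \<otimes>\<^bsub>G\<^esub> h) p
      = compose (X \<times> Y) (diag_action X \<phi> Y \<psi> g) (diag_action X \<phi> Y \<psi> h) p"
    proof (cases "p \<in> X \<times> Y")
      case True
      then obtain x y where p: "p = (x, y)" "x \<in> X" "y \<in> Y" by blast
      have "\<phi> h x \<in> X" "\<psi> h y \<in> Y"
        using p h A.element_image B.element_image by blast+
      then show ?thesis
        using p A.composition_rule[OF p(2) g h] B.composition_rule[OF p(3) g h]
        by (simp add: diag_action_def compose_def)
    qed (simp add: diag_action_def compose_def)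
  qed
  then have "diag_action X \<phi> Y \<psi> \<in> hom G (BijGroup (X \<times> Y))"
    using bij by (simp add: hom_def BijGroup_def)
  then show ?thesis
    by (simp add: group_action_def group_hom_def group_hom_axioms_def group_hom.axioms(1)[OF A.group_hom] group_BijGroup)
qed

lemma image_G_map_orbit:
  assumes "h \<in> G_maps G X \<phi> Y \<psi>" and "x \<in> X"
  shows "h ` orbit G \<phi> x = orbit G \<psi> (h x)"
  using assms unfolding G_maps_def orbit_def by (auto simp: image_iff) metis

lemma map_prod_G_maps:
  assumes "h \<in> G_maps G X \<phi> Y \<psi>" and "h' \<in> G_maps G X' \<phi>' Y' \<psi>'"
  shows "map_prod h h' \<in> G_maps G (X \<times> X') (diag_action X \<phi> X' \<phi>') (Y \<times> Y') (diag_action Y \<psi> Y' \<psi>')"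
  using assms by (auto simp: G_maps_def diag_action_def)

end

theory Submission
  imports Defs
begin

text \<open>
  Take \<open>Y\<^sub>i = X\<^sub>i / N\<close>, the set of \<open>N\<close>-orbits, for a normal subgroup \<open>N\<close> of \<open>G\<close> that is maximal, as far as
  its orbits on \<open>X\<^sub>1\<close> and \<open>X\<^sub>2\<close> are concerned, among those for which \<open>X\<^sub>1 \<times> X\<^sub>2 \<rightarrow> X\<^sub>1/N \<times> X\<^sub>2/N\<close>
  separates \<open>G\<close>-orbits; finiteness provides such an \<open>N\<close>. The kernel \<open>K\<close> of \<open>X\<^sub>1/N\<close> contains \<open>N\<close>,
  has the same orbits as \<open>N\<close> on \<open>X\<^sub>1\<close>, and again separates \<open>G\<close>-orbits, because an element
  of \<open>K\<close> can be used to correct the second coordinate without moving the first one in \<open>X\<^sub>1/N\<close>.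
  By maximality \<open>K\<close> has the same orbits as \<open>N\<close> on \<open>X\<^sub>2\<close>, so \<open>K\<close> acts trivially on \<open>X\<^sub>2/N\<close>.
  By symmetry the two kernels agree.
\<close>

section \<open>Orbits of a normal subgroup and the action of the whole group on them\<close>

text \<open>Acting by images of sets avoids a choice of representatives. The restriction to the
  orbit set makes the values extensional, as \<open>BijGroup\<close> demands.\<close>

definition quotient_action ::
    "('g, 'm) monoid_scheme \<Rightarrow> 'g set \<Rightarrow> 'a set \<Rightarrow> ('g \<Rightarrow> 'a \<Rightarrow> 'a) \<Rightarrow> 'g \<Rightarrow> 'a set \<Rightarrow> 'a set" where
  "quotient_action G N E \<phi> g = (\<lambda>S\<in>orbits (G\<lparr>carrier := N\<rparr>) E \<phi>. \<phi> g ` S)"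

lemma (in group_action) orbit_subset:
  assumes "x \<in> E"
  shows "orbit G \<phi> x \<subseteq> E"
  using assms element_image by (auto simp: orbit_def)

lemma (in group_action) orbit_eq_iff:
  assumes "x \<in> E" and "y \<in> E"
  shows "orbit G \<phi> x = orbit G \<phi> y \<longleftrightarrow> x \<in> orbit G \<phi> y"
proof
  assume "orbit G \<phi> x = orbit G \<phi> y"
  then show "x \<in> orbit G \<phi> y"
    using assms orbit_refl by blast
next
  assume x: "x \<in> orbit G \<phi> y"
  then have y: "y \<in> orbit G \<phi> x"
    using assms orbit_sym by blast
  have "z \<in> orbit G \<phi> x \<longleftrightarrow> z \<in> orbit G \<phi> y" if "z \<in> E" for z
    using x y assms that orbit_trans by blast
  then show "orbit G \<phi> x = orbit G \<phi> y"
    using assms orbit_subset by blast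
qed

text \<open>Conjugation by \<open>g\<close> and by \<open>inv g\<close> preserves \<open>N\<close>.
  Moving \<open>g\<close> to the left of an element of \<open>N\<close> or to its right costs only
  such a conjugation; \<open>push\<close> gives one inclusion and \<open>pull\<close> the
  other.\<close>

lemma (in group_action) image_normal_orbit:
  assumes N: "N \<lhd> G" and g: "g \<in> carrier G" and x: "x \<in> E"
  shows "\<phi> g ` orbit (G\<lparr>carrier := N\<rparr>) \<phi> x = orbit (G\<lparr>carrier := N\<rparr>) \<phi> (\<phi> g x)"
proof -
  interpret N: normal N G by (rule N)
  have push: "\<phi> g (\<phi> n x) = \<phi> (g \<otimes> n \<otimes> inv g) (\<phi> g x)" if "n \<in> N" for n
  proof -
    have n: "n \<in> carrier G" using that by simp
    then have "g \<otimes> n \<otimes> inv g \<otimes> g = g \<otimes> n"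
      using g by (simp add: N.m_assoc)
    then show ?thesis
      using composition_rule[OF x g n] composition_rule[OF x _ g, of "g \<otimes> n \<otimes> inv g"] g n by simp
  qed
  have conj: "g \<otimes> n \<otimes> inv g \<in> N" "inv g \<otimes> n \<otimes> g \<in> N" if "n \<in> N" for n
    using N.inv_op_closed1 N.inv_op_closed2 g that by auto
  have pull: "\<phi> n (\<phi> g x) = \<phi> g (\<phi> (inv g \<otimes> n \<otimes> g) x)" if "n \<in> N" for n
  proof -
    have n: "n \<in> carrier G" using that by simp
    have "g \<otimes> (inv g \<otimes> n \<otimes> g) \<otimes> inv g = n"
      using g n by (metis N.inv_closed N.inv_solve_left N.inv_solve_right N.m_assoc N.m_closed)
    then show ?thesis using push[OF conj(2)[OF that]] by simp
  qed
  have "\<phi> g (\<phi> n x) \<in> orbit (G\<lparr>carrier := N\<rparr>) \<phi> (\<phi> g x)" if "n \<in> N" for n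
    unfolding push[OF that] using conj(1)[OF that] by (auto simp: orbit_def)
  moreover have "\<phi> n (\<phi> g x) \<in> \<phi> g ` orbit (G\<lparr>carrier := N\<rparr>) \<phi> x" if "n \<in> N" for n
    unfolding pull[OF that] using conj(2)[OF that] by (auto simp: orbit_def)
  ultimately show ?thesis
    unfolding orbit_def by auto
qed

lemma (in group_action) quotient_action_orbit:
  assumes "N \<lhd> G" and "g \<in> carrier G" and "x \<in> E"
  shows "quotient_action G N E \<phi> g (orbit (G\<lparr>carrier := N\<rparr>) \<phi> x)
    = orbit (G\<lparr>carrier := N\<rparr>) \<phi> (\<phi> g x)"
  using assms image_normal_orbit by (auto simp: quotient_action_def orbits_def)

lemma (in group_action) group_action_quotient:
  assumes N: "N \<lhd> G"
  shows "group_action G (orbits (G\<lparr>carrier := N\<rparr>) E \<phi>) (quotient_action G N E \<phi>)"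
proof -
  interpret N: normal N G by (rule N)
  let ?Q = "orbits (G\<lparr>carrier := N\<rparr>) E \<phi>"
  let ?o = "orbit (G\<lparr>carrier := N\<rparr>) \<phi>"
  let ?\<psi> = "quotient_action G N E \<phi>"
  have closed: "?\<psi> g S \<in> ?Q" if g: "g \<in> carrier G" and S: "S \<in> ?Q" for g S
  proof -
    obtain x where x: "x \<in> E" "S = ?o x" using S by (auto simp: orbits_def)
    then show ?thesis
      using quotient_action_orbit[OF N g x(1)] element_image[OF g x(1)]
      by (auto simp: orbits_def)
  qed
  have inverse: "?\<psi> (inv g) (?\<psi> g S) = S" if g: "g \<in> carrier G" and S: "S \<in> ?Q" for g S
  proof -
    obtain x where x: "x \<in> E" "S = ?o x" using S by (auto simp: orbits_def)
    then show ?thesis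
      using g element_image[OF g x(1)] orbit_sym_aux[OF g x(1)]
      by (simp add: quotient_action_orbit[OF N])
  qed
  have bij: "?\<psi> g \<in> Bij ?Q" if g: "g \<in> carrier G" for g
  proof -
    \<comment> \<open>The action of \<open>inv g\<close> is the inverse map: \<open>inverse\<close>
      at \<open>g\<close> makes it a left inverse, at \<open>inv g\<close> a right inverse.\<close>
    have "bij_betw (?\<psi> g) ?Q ?Q"
      by (rule bij_betw_byWitness[where f' = "?\<psi> (inv g)"])
        (use g closed inverse inverse[of "inv g"] in auto)
    then show ?thesis by (simp add: Bij_def quotient_action_def)
  qed
  have "?\<psi> (g \<otimes> h) = compose ?Q (?\<psi> g) (?\<psi> h)" if g: "g \<in> carrier G" and h: "h \<in> carrier G" for g h
  proof
    fix S
    show "?\<psi> (g \<otimes> h) S = compose ?Q (?\<psi> g) (?\<psi> h) S"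
    proof (cases "S \<in> ?Q")
      case True
      then obtain x where x: "x \<in> E" "S = ?o x" by (auto simp: orbits_def)
      then have "\<phi> h x \<in> E" using h element_image by blast
      then show ?thesis
        using True x g h by (simp add: compose_eq quotient_action_orbit[OF N] composition_rule)
    qed (simp add: quotient_action_def compose_def)
  qed
  then have "?\<psi> \<in> hom G (BijGroup ?Q)"
    using bij by (simp add: hom_def BijGroup_def)
  then show ?thesis
    by (simp add: group_action_def group_hom_def group_hom_axioms_def N.is_group group_BijGroup)
qed

lemma (in group_action) orbit_in_G_maps:
  assumes "N \<lhd> G"
  shows "orbit (G\<lparr>carrier := N\<rparr>) \<phi>
    \<in> G_maps G E \<phi> (orbits (G\<lparr>carrier := N\<rparr>) E \<phi>) (quotient_action G N E \<phi>)"
  using quotient_action_orbit[OF assms] by (auto simp: G_maps_def orbits_def)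

section \<open>The Galois group of a quotient\<close>

text \<open>The Galois group is the kernel, and \<open>g\<close> fixes the orbit of \<open>x\<close>
  exactly when the orbits of \<open>\<phi> g x\<close> and \<open>x\<close> under \<open>N\<close>
  coincide. This pointwise form is the one that later arguments use.\<close>

lemma (in group_action) galois_group_quotient:
  assumes N: "N \<lhd> G"
  shows "galois_group G (orbits (G\<lparr>carrier := N\<rparr>) E \<phi>) (quotient_action G N E \<phi>)
    = {g \<in> carrier G. \<forall>x\<in>E. \<phi> g x \<in> orbit (G\<lparr>carrier := N\<rparr>) \<phi> x}"
proof -
  let ?Q = "orbits (G\<lparr>carrier := N\<rparr>) E \<phi>"
  interpret Q: group_action G ?Q "quotient_action G N E \<phi>"
    by (rule group_action_quotient[OF N])
  interpret N: group_action "G\<lparr>carrier := N\<rparr>" E \<phi>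
    using N induced_action normal_imp_subgroup by blast
  have "g \<in> kernel G (BijGroup ?Q) (quotient_action G N E \<phi>)
      \<longleftrightarrow> (\<forall>x\<in>E. \<phi> g x \<in> orbit (G\<lparr>carrier := N\<rparr>) \<phi> x)" if g: "g \<in> carrier G" for g
  proof -
    have "quotient_action G N E \<phi> g (orbit (G\<lparr>carrier := N\<rparr>) \<phi> x) = orbit (G\<lparr>carrier := N\<rparr>) \<phi> x
        \<longleftrightarrow> \<phi> g x \<in> orbit (G\<lparr>carrier := N\<rparr>) \<phi> x" if "x \<in> E" for x
      using quotient_action_orbit[OF N g that] N.orbit_eq_iff[OF _ that] element_image[OF g that] by simp
    then show ?thesis
      unfolding Q.kernel_fixes_iff[OF g] by (auto simp: orbits_def)
  qed
  then show ?thesis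
    unfolding Q.galois_group_eq_kernel by (auto simp: kernel_def)
qed

text \<open>Elements of \<open>K\<close> move no point out of its \<open>N\<close>-orbit, and
  \<open>N\<close> is contained in \<open>K\<close>, so passing from \<open>N\<close> to
  \<open>K\<close> does not enlarge the orbits on \<open>E\<close>.\<close>

lemma (in group_action) orbit_galois_group_quotient:
  assumes N: "N \<lhd> G" and x: "x \<in> E"
  defines "K \<equiv> galois_group G (orbits (G\<lparr>carrier := N\<rparr>) E \<phi>) (quotient_action G N E \<phi>)"
  shows "orbit (G\<lparr>carrier := K\<rparr>) \<phi> x = orbit (G\<lparr>carrier := N\<rparr>) \<phi> x"
proof -
  interpret N: normal N G by (rule N)
  have "N \<subseteq> K"
    unfolding K_def galois_group_quotient[OF N] by (auto simp: orbit_def)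
  then show ?thesis
    using x unfolding K_def galois_group_quotient[OF N] by (auto simp: orbit_def)
qed

lemma (in group_action) normal_galois_group: "galois_group G E \<phi> \<lhd> G"
  using galois_group_normal_stabilizer by (simp add: normal_stabilizer_def)

section \<open>When a G-map is bijective on orbits\<close>

text \<open>Since \<open>h\<close> sends orbits onto orbits, \<open>surj\<close> yields surjectivity
  on orbit sets, while \<open>sep\<close> is injectivity on orbits expressed through points.\<close>

lemma bij_betw_orbits_G_map:
  assumes "group_action G X \<phi>" and "group_action G Y \<psi>"
    and h: "h \<in> G_maps G X \<phi> Y \<psi>" and surj: "h ` X = Y"
    and sep: "\<And>x x'. \<lbrakk>x \<in> X; x' \<in> X; h x \<in> orbit G \<psi> (h x')\<rbrakk> \<Longrightarrow> x \<in> orbit G \<phi> x'"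
  shows "bij_betw ((`) h) (orbits G X \<phi>) (orbits G Y \<psi>)"
proof -
  interpret X: group_action G X \<phi> by fact
  interpret Y: group_action G Y \<psi> by fact
  have im: "h ` orbit G \<phi> x = orbit G \<psi> (h x)" if "x \<in> X" for x
    using image_G_map_orbit[OF h that] .
  have "inj_on ((`) h) (orbits G X \<phi>)"
  proof (rule inj_onI)
    fix S T
    assume "S \<in> orbits G X \<phi>" and "T \<in> orbits G X \<phi>" and eq: "h ` S = h ` T"
    then obtain x x' where x: "x \<in> X" "S = orbit G \<phi> x" and x': "x' \<in> X" "T = orbit G \<phi> x'"
      by (auto simp: orbits_def)
    have "orbit G \<psi> (h x) = orbit G \<psi> (h x')"
      using eq x x' im by simp
    moreover have "h x \<in> Y" "h x' \<in> Y" using x x' surj by auto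
    ultimately have "h x \<in> orbit G \<psi> (h x')"
      using Y.orbit_eq_iff by simp
    then show "S = T"
      using sep[OF x(1) x'(1)] X.orbit_eq_iff[OF x(1) x'(1)] x(2) x'(2) by simp
  qed
  moreover have "(`) h ` orbits G X \<phi> = orbits G Y \<psi>"
  proof -
    have "(`) h ` orbits G X \<phi> = (\<lambda>x. orbit G \<psi> (h x)) ` X"
      unfolding orbits_def Setcompr_eq_image image_image using im by (intro image_cong) auto
    also have "\<dots> = orbits G Y \<psi>"
      unfolding orbits_def Setcompr_eq_image surj[symmetric] by (simp add: image_image)
    finally show ?thesis .
  qed
  ultimately show ?thesis by (simp add: bij_betw_def)
qed

section \<open>Normal subgroups whose quotients separate orbits of the product\<close>

text \<open>This is injectivity on \<open>G\<close>-orbits of the map from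
  \<open>X \<times> Y\<close> to the product of the quotients by \<open>N\<close>, stated without
  quotients. The elements of \<open>N\<close> that take \<open>x'\<close> to
  \<open>\<phi> g x\<close> and \<open>y'\<close> to \<open>\<psi> g y\<close> may differ; a common
  one would give \<open>h\<close> at once.\<close>

definition orbit_separating ::
    "('g, 'm) monoid_scheme \<Rightarrow> 'a set \<Rightarrow> ('g \<Rightarrow> 'a \<Rightarrow> 'a) \<Rightarrow> 'b set \<Rightarrow> ('g \<Rightarrow> 'b \<Rightarrow> 'b) \<Rightarrow> 'g set \<Rightarrow> bool" where
  "orbit_separating G X \<phi> Y \<psi> N \<longleftrightarrow> N \<lhd> G \<and>
    (\<forall>x\<in>X. \<forall>x'\<in>X. \<forall>y\<in>Y. \<forall>y'\<in>Y. \<forall>g\<in>carrier G.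
      \<phi> g x \<in> orbit (G\<lparr>carrier := N\<rparr>) \<phi> x' \<longrightarrow> \<psi> g y \<in> orbit (G\<lparr>carrier := N\<rparr>) \<psi> y' \<longrightarrow>
      (\<exists>h\<in>carrier G. \<phi> h x = x' \<and> \<psi> h y = y'))"

lemma orbit_separating_commute:
  "orbit_separating G X \<phi> Y \<psi> N \<longleftrightarrow> orbit_separating G Y \<psi> X \<phi> N"
  unfolding orbit_separating_def by blast

text \<open>Orbits of the trivial group are singletons, so \<open>h = g\<close> works. This makes
  the family in which a maximal member is sought nonempty.\<close>

lemma orbit_separating_one:
  assumes "group_action G X \<phi>" and "group_action G Y \<psi>"
  shows "orbit_separating G X \<phi> Y \<psi> {\<one>\<^bsub>G\<^esub>}"
proof -
  interpret A: group_action G X \<phi> by fact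
  interpret B: group_action G Y \<psi> by fact
  interpret group G by (rule group_hom.axioms(1)[OF A.group_hom])
  have "\<phi> \<one>\<^bsub>G\<^esub> x = x" if "x \<in> X" for x
    using that by (simp flip: A.id_eq_one)
  moreover have "\<psi> \<one>\<^bsub>G\<^esub> y = y" if "y \<in> Y" for y
    using that by (simp flip: B.id_eq_one)
  ultimately show ?thesis
    using one_is_normal unfolding orbit_separating_def orbit_def by auto
qed

text \<open>If \<open>\<psi> g y = \<psi> k y'\<close> with \<open>k\<close> in the Galois group,
  replace \<open>g\<close> by \<open>inv k\<close> times \<open>g\<close>. This sends
  \<open>y\<close> exactly to \<open>y'\<close> and still sends \<open>x\<close> into the
  \<open>N\<close>-orbit of \<open>x'\<close>, so separation for \<open>N\<close> applies.\<close>

lemma orbit_separating_galois_group: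
  assumes "group_action G X \<phi>" and "group_action G Y \<psi>" and sep: "orbit_separating G X \<phi> Y \<psi> N"
  shows "orbit_separating G X \<phi> Y \<psi>
    (galois_group G (orbits (G\<lparr>carrier := N\<rparr>) X \<phi>) (quotient_action G N X \<phi>))"
    (is "orbit_separating _ _ _ _ _ ?K")
proof -
  interpret A: group_action G X \<phi> by fact
  interpret B: group_action G Y \<psi> by fact
  have N: "N \<lhd> G" using sep by (simp add: orbit_separating_def)
  have K: "?K \<lhd> G"
    using group_action.normal_galois_group[OF A.group_action_quotient[OF N]] .
  interpret K: normal ?K G by (rule K)
  interpret NX: group_action "G\<lparr>carrier := N\<rparr>" X \<phi>
    using N A.induced_action normal_imp_subgroup by blast
  interpret NY: group_action "G\<lparr>carrier := N\<rparr>" Y \<psi>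
    using N B.induced_action normal_imp_subgroup by blast
  have "\<exists>h\<in>carrier G. \<phi> h x = x' \<and> \<psi> h y = y'"
    if x: "x \<in> X" "x' \<in> X" and y: "y \<in> Y" "y' \<in> Y" and g: "g \<in> carrier G"
      and gx: "\<phi> g x \<in> orbit (G\<lparr>carrier := ?K\<rparr>) \<phi> x'"
      and gy: "\<psi> g y \<in> orbit (G\<lparr>carrier := ?K\<rparr>) \<psi> y'" for x x' y y' g
  proof -
    obtain k where k: "k \<in> ?K" "\<psi> g y = \<psi> k y'"
      using gy by (auto simp: orbit_def)
    have kG: "k \<in> carrier G" "inv\<^bsub>G\<^esub> k \<in> carrier G" using k by simp_all
    have gxX: "\<phi> g x \<in> X" using A.element_image g x by blast
    have "inv\<^bsub>G\<^esub> k \<in> ?K" using k by simp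
    \<comment> \<open>The correction by \<open>inv k\<close> is harmless on \<open>X\<close>,
      because the Galois group preserves each \<open>N\<close>-orbit there.\<close>
    then have "\<phi> (inv\<^bsub>G\<^esub> k) (\<phi> g x) \<in> orbit (G\<lparr>carrier := N\<rparr>) \<phi> (\<phi> g x)"
      using gxX unfolding A.galois_group_quotient[OF N] by blast
    moreover have "\<phi> g x \<in> orbit (G\<lparr>carrier := N\<rparr>) \<phi> x'"
      using gx A.orbit_galois_group_quotient[OF N x(2)] by simp
    ultimately have "\<phi> (inv\<^bsub>G\<^esub> k \<otimes>\<^bsub>G\<^esub> g) x \<in> orbit (G\<lparr>carrier := N\<rparr>) \<phi> x'"
      using A.composition_rule[OF x(1) kG(2) g] NX.orbit_eq_iff[OF gxX x(2)] by simp
    moreover have "\<psi> (inv\<^bsub>G\<^esub> k \<otimes>\<^bsub>G\<^esub> g) y = y'"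
      using B.composition_rule[OF y(1) kG(2) g] B.orbit_sym_aux[OF kG(1) y(2)] k(2) by simp
    then have "\<psi> (inv\<^bsub>G\<^esub> k \<otimes>\<^bsub>G\<^esub> g) y \<in> orbit (G\<lparr>carrier := N\<rparr>) \<psi> y'"
      using NY.orbit_refl[OF y(2)] by simp
    moreover have "inv\<^bsub>G\<^esub> k \<otimes>\<^bsub>G\<^esub> g \<in> carrier G" using kG g by simp
    ultimately show ?thesis
      using sep x y unfolding orbit_separating_def by blast
  qed
  then show ?thesis using K unfolding orbit_separating_def by blast
qed

text \<open>The product of the two projections is a surjective G-map, and separation of orbits is
  the remaining condition of \<open>bij_betw_orbits_G_map\<close>.\<close>

lemma bij_betw_orbits_quotient:
  assumes "group_action G X \<phi>" and "group_action G Y \<psi>" and sep: "orbit_separating G X \<phi> Y \<psi> N"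
  shows "bij_betw
    ((`) (map_prod (orbit (G\<lparr>carrier := N\<rparr>) \<phi>) (orbit (G\<lparr>carrier := N\<rparr>) \<psi>)))
    (orbits G (X \<times> Y) (diag_action X \<phi> Y \<psi>))
    (orbits G (orbits (G\<lparr>carrier := N\<rparr>) X \<phi> \<times> orbits (G\<lparr>carrier := N\<rparr>) Y \<psi>)
      (diag_action (orbits (G\<lparr>carrier := N\<rparr>) X \<phi>) (quotient_action G N X \<phi>)
        (orbits (G\<lparr>carrier := N\<rparr>) Y \<psi>) (quotient_action G N Y \<psi>)))"
proof -
  interpret A: group_action G X \<phi> by fact
  interpret B: group_action G Y \<psi> by fact
  have N: "N \<lhd> G" using sep by (simp add: orbit_separating_def)
  interpret NX: group_action "G\<lparr>carrier := N\<rparr>" X \<phi>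
    using N A.induced_action normal_imp_subgroup by blast
  interpret NY: group_action "G\<lparr>carrier := N\<rparr>" Y \<psi>
    using N B.induced_action normal_imp_subgroup by blast
  let ?p = "orbit (G\<lparr>carrier := N\<rparr>) \<phi>" and ?q = "orbit (G\<lparr>carrier := N\<rparr>) \<psi>"
  let ?X = "orbits (G\<lparr>carrier := N\<rparr>) X \<phi>" and ?Y = "orbits (G\<lparr>carrier := N\<rparr>) Y \<psi>"
  let ?D = "diag_action ?X (quotient_action G N X \<phi>) ?Y (quotient_action G N Y \<psi>)"
  show ?thesis
  proof (rule bij_betw_orbits_G_map)
    show "group_action G (X \<times> Y) (diag_action X \<phi> Y \<psi>)"
      using A.group_action_axioms B.group_action_axioms by (rule group_action_diag_action)
    show "group_action G (?X \<times> ?Y) ?D"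
      using A.group_action_quotient[OF N] B.group_action_quotient[OF N] by (rule group_action_diag_action)
    show "map_prod ?p ?q \<in> G_maps G (X \<times> Y) (diag_action X \<phi> Y \<psi>) (?X \<times> ?Y) ?D"
      using A.orbit_in_G_maps[OF N] B.orbit_in_G_maps[OF N] by (rule map_prod_G_maps)
    have "?X = ?p ` X" "?Y = ?q ` Y" by (auto simp: orbits_def)
    then show "map_prod ?p ?q ` (X \<times> Y) = ?X \<times> ?Y"
      by (simp add: map_prod_surj_on)
  next
    fix u v
    assume u: "u \<in> X \<times> Y" and v: "v \<in> X \<times> Y"
      and uv: "map_prod ?p ?q u \<in> orbit G ?D (map_prod ?p ?q v)"
    \<comment> \<open>The primes go to \<open>u\<close> because \<open>g\<close> moves the image of
      \<open>v\<close> to that of \<open>u\<close>, matching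
      \<open>orbit_separating\<close>.\<close>
    obtain x' y' where u': "u = (x', y')" "x' \<in> X" "y' \<in> Y" using u by blast
    obtain x y where v': "v = (x, y)" "x \<in> X" "y \<in> Y" using v by blast
    obtain g where g: "g \<in> carrier G" and "?D g (?p x, ?q y) = (?p x', ?q y')"
      using uv u' v' by (auto simp: orbit_def)
    moreover have "?p x \<in> ?X" "?q y \<in> ?Y" using v' by (auto simp: orbits_def)
    ultimately have "?p (\<phi> g x) = ?p x'" "?q (\<psi> g y) = ?q y'"
      using A.quotient_action_orbit[OF N g v'(2)] B.quotient_action_orbit[OF N g v'(3)]
      by (simp_all add: diag_action_def)
    moreover have "\<phi> g x \<in> X" "\<psi> g y \<in> Y"
      using A.element_image B.element_image g v' by blast+
    ultimately have "\<phi> g x \<in> ?p x'" "\<psi> g y \<in> ?q y'"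
      using NX.orbit_eq_iff NY.orbit_eq_iff u' by blast+
    then obtain h where "h \<in> carrier G" "\<phi> h x = x'" "\<psi> h y = y'"
      using sep g u' v' unfolding orbit_separating_def by blast
    then show "u \<in> orbit G (diag_action X \<phi> Y \<psi>) v"
      using u' v' by (force simp: orbit_def diag_action_def)
  qed
qed

text \<open>The Galois group of the quotient of \<open>X\<close> contains \<open>N\<close> and again
  separates orbits, so by maximality it has the \<open>N\<close>-orbits on \<open>Y\<close> and
  hence fixes every point of the quotient of \<open>Y\<close>. Exchanging \<open>X\<close> and
  \<open>Y\<close> will give the reverse inclusion.\<close>

lemma galois_group_quotient_subset:
  assumes "group_action G X \<phi>" and "group_action G Y \<psi>" and sep: "orbit_separating G X \<phi> Y \<psi> N"
    and maximal: "\<And>K. \<lbrakk>orbit_separating G X \<phi> Y \<psi> K; N \<subseteq> K\<rbrakk>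
      \<Longrightarrow> \<forall>y\<in>Y. orbit (G\<lparr>carrier := K\<rparr>) \<psi> y = orbit (G\<lparr>carrier := N\<rparr>) \<psi> y"
  shows "galois_group G (orbits (G\<lparr>carrier := N\<rparr>) X \<phi>) (quotient_action G N X \<phi>)
    \<subseteq> galois_group G (orbits (G\<lparr>carrier := N\<rparr>) Y \<psi>) (quotient_action G N Y \<psi>)"
    (is "?K \<subseteq> _")
proof -
  interpret A: group_action G X \<phi> by fact
  interpret B: group_action G Y \<psi> by fact
  have N: "N \<lhd> G" using sep by (simp add: orbit_separating_def)
  then have "N \<subseteq> carrier G"
    using normal_imp_subgroup subgroup.subset by blast
  then have "N \<subseteq> ?K"
    unfolding A.galois_group_quotient[OF N] by (auto simp: orbit_def)
  then have "\<forall>y\<in>Y. orbit (G\<lparr>carrier := ?K\<rparr>) \<psi> y = orbit (G\<lparr>carrier := N\<rparr>) \<psi> y"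
    using maximal orbit_separating_galois_group assms(1-3) by blast
  moreover have "\<psi> k y \<in> orbit (G\<lparr>carrier := ?K\<rparr>) \<psi> y" if "k \<in> ?K" for k y
    using that by (auto simp: orbit_def)
  ultimately show ?thesis
    unfolding B.galois_group_quotient[OF N] using A.galois_group_quotient[OF N] by blast
qed

section \<open>Maximal separating subgroups from finiteness, and the conclusion\<close>

text \<open>\<open>G\<close> may be infinite, so maximality is sought among the orbit relations on
  the finite sets \<open>X\<close> and \<open>Y\<close> rather than among the subgroups
  themselves.\<close>

lemma ex_maximal_orbit_separating:
  assumes "group_action G X \<phi>" and "finite X" and "group_action G Y \<psi>" and "finite Y"
  obtains N where "orbit_separating G X \<phi> Y \<psi> N"
    and "\<And>K. \<lbrakk>orbit_separating G X \<phi> Y \<psi> K; N \<subseteq> K\<rbrakk>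
      \<Longrightarrow> (\<forall>x\<in>X. orbit (G\<lparr>carrier := K\<rparr>) \<phi> x = orbit (G\<lparr>carrier := N\<rparr>) \<phi> x) \<and>
        (\<forall>y\<in>Y. orbit (G\<lparr>carrier := K\<rparr>) \<psi> y = orbit (G\<lparr>carrier := N\<rparr>) \<psi> y)"
proof -
  \<comment> \<open>The disjoint sum packs both orbit relations into one set that grows with
    \<open>N\<close>, so a single maximal element controls \<open>X\<close> and \<open>Y\<close> at
    once.\<close>
  let ?R = "\<lambda>N. (SIGMA x:X. orbit (G\<lparr>carrier := N\<rparr>) \<phi> x) <+> (SIGMA y:Y. orbit (G\<lparr>carrier := N\<rparr>) \<psi> y)"
  let ?F = "?R ` {N. orbit_separating G X \<phi> Y \<psi> N}"
  have "?R N \<subseteq> (X \<times> X) <+> (Y \<times> Y)" if "orbit_separating G X \<phi> Y \<psi> N" for N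
  proof -
    have "N \<lhd> G" using that by (simp add: orbit_separating_def)
    then have "group_action (G\<lparr>carrier := N\<rparr>) X \<phi>" "group_action (G\<lparr>carrier := N\<rparr>) Y \<psi>"
      using assms group_action.induced_action normal_imp_subgroup by blast+
    from this[THEN group_action.orbit_subset] show ?thesis by auto
  qed
  then have "?F \<subseteq> Pow ((X \<times> X) <+> (Y \<times> Y))" by blast
  moreover have "finite ((X \<times> X) <+> (Y \<times> Y))" using assms by simp
  ultimately have "finite ?F" by (meson finite_Pow_iff finite_subset)
  moreover have "?F \<noteq> {}" using orbit_separating_one assms by blast
  ultimately obtain N where N: "orbit_separating G X \<phi> Y \<psi> N"
    and max: "\<And>K. \<lbrakk>orbit_separating G X \<phi> Y \<psi> K; ?R N \<subseteq> ?R K\<rbrakk> \<Longrightarrow> ?R N = ?R K"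
    using finite_has_maximal[of ?F] by auto
  show ?thesis
  proof (rule that[OF N])
    fix K
    assume K: "orbit_separating G X \<phi> Y \<psi> K" and "N \<subseteq> K"
    then have "?R N \<subseteq> ?R K" by (auto simp: orbit_def)
    from max[OF K this]
    \<comment> \<open>Equality of the packed sets is read back on each summand by testing
      \<open>Inl\<close> and \<open>Inr\<close> pairs.\<close>
    have eq: "z \<in> ?R K \<longleftrightarrow> z \<in> ?R N" for z by simp
    have "x' \<in> orbit (G\<lparr>carrier := K\<rparr>) \<phi> x \<longleftrightarrow> x' \<in> orbit (G\<lparr>carrier := N\<rparr>) \<phi> x" if "x \<in> X" for x x'
      using eq[of "Inl (x, x')"] that by auto
    moreover have "y' \<in> orbit (G\<lparr>carrier := K\<rparr>) \<psi> y \<longleftrightarrow> y' \<in> orbit (G\<lparr>carrier := N\<rparr>) \<psi> y" if "y \<in> Y" for y y'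
      using eq[of "Inr (y, y')"] that by auto
    ultimately show "(\<forall>x\<in>X. orbit (G\<lparr>carrier := K\<rparr>) \<phi> x = orbit (G\<lparr>carrier := N\<rparr>) \<phi> x) \<and>
        (\<forall>y\<in>Y. orbit (G\<lparr>carrier := K\<rparr>) \<psi> y = orbit (G\<lparr>carrier := N\<rparr>) \<psi> y)"
      by blast
  qed
qed

theorem theorem2p6:
  fixes G :: "('g, 'm) monoid_scheme"
    and X1 :: "'a set" and \<phi>1 :: "'g \<Rightarrow> 'a \<Rightarrow> 'a"
    and X2 :: "'b set" and \<phi>2 :: "'g \<Rightarrow> 'b \<Rightarrow> 'b"
  assumes "group G"
    and "group_action G X1 \<phi>1" and "finite X1"
    and "group_action G X2 \<phi>2" and "finite X2"
  shows "\<exists>(Y1 :: 'a set set) \<psi>1 (Y2 :: 'b set set) \<psi>2 h1 h2.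
    group_action G Y1 \<psi>1 \<and> group_action G Y2 \<psi>2 \<and>
    h1 \<in> G_maps G X1 \<phi>1 Y1 \<psi>1 \<and> h2 \<in> G_maps G X2 \<phi>2 Y2 \<psi>2 \<and>
    same_galois_closure G Y1 \<psi>1 Y2 \<psi>2 \<and>
    bij_betw (\<lambda>S. map_prod h1 h2 ` S)
      (orbits G (X1 \<times> X2) (diag_action X1 \<phi>1 X2 \<phi>2))
      (orbits G (Y1 \<times> Y2) (diag_action Y1 \<psi>1 Y2 \<psi>2))"
proof -
  obtain N where sep: "orbit_separating G X1 \<phi>1 X2 \<phi>2 N"
    and maximal: "\<And>K. \<lbrakk>orbit_separating G X1 \<phi>1 X2 \<phi>2 K; N \<subseteq> K\<rbrakk>
      \<Longrightarrow> (\<forall>x\<in>X1. orbit (G\<lparr>carrier := K\<rparr>) \<phi>1 x = orbit (G\<lparr>carrier := N\<rparr>) \<phi>1 x) \<and>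
        (\<forall>y\<in>X2. orbit (G\<lparr>carrier := K\<rparr>) \<phi>2 y = orbit (G\<lparr>carrier := N\<rparr>) \<phi>2 y)"
    by (rule ex_maximal_orbit_separating[OF assms(2-5)]) blast
  have N: "N \<lhd> G" using sep by (simp add: orbit_separating_def)
  let ?Y1 = "orbits (G\<lparr>carrier := N\<rparr>) X1 \<phi>1" and ?\<psi>1 = "quotient_action G N X1 \<phi>1"
  let ?Y2 = "orbits (G\<lparr>carrier := N\<rparr>) X2 \<phi>2" and ?\<psi>2 = "quotient_action G N X2 \<phi>2"
  have "galois_group G ?Y1 ?\<psi>1 \<subseteq> galois_group G ?Y2 ?\<psi>2"
    using galois_group_quotient_subset[OF assms(2,4) sep] maximal by blast
  moreover have "galois_group G ?Y2 ?\<psi>2 \<subseteq> galois_group G ?Y1 ?\<psi>1"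
    \<comment> \<open>The same inclusion with the roles exchanged. Instantiating commutativity at
      \<open>X2\<close> rewrites only towards the order with \<open>X1\<close> first, in which
      \<open>sep\<close> and \<open>maximal\<close> are stated.\<close>
    using galois_group_quotient_subset[OF assms(4,2)] sep maximal
    unfolding orbit_separating_commute[of G X2] by blast
  ultimately have "same_galois_closure G ?Y1 ?\<psi>1 ?Y2 ?\<psi>2"
    by (simp add: same_galois_closure_def)
  then show ?thesis
    using assms(2,4)[THEN group_action.group_action_quotient, OF N]
      assms(2,4)[THEN group_action.orbit_in_G_maps, OF N]
      bij_betw_orbits_quotient[OF assms(2,4) sep]
    by blast
qed

end
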